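(* Let $(X,T)$ be a topological dynamical system, let $\imath:X\to X$ be a continuous involution commuting with $T$, and let $(\overline{X},\overline{T})$ be the system obtained from $(X,T)$ by halving with respect to $\imath$. Then, for any integer $n\ge 1$: (a) $\frac12\,\mathsf{F}_T(n)\le \mathsf{F}_{\overline{T}}(n)\le \frac12\left(\mathsf{F}_T(n)+\mathsf{F}_T(2n)\right)$; (b) $\mathsf{O}_{\overline{T}}(n)\le \mathsf{O}_T(n)+\mathsf{O}_T(2n)$, and if $n$ is odd then $\mathsf{O}_{\overline{T}}(n)\ge \frac12\,\mathsf{O}_T(n)$.
   Context: A topological dynamical system is a pair $(X,T)$ where $X$ is a compact metric space and $T:X\to X$ is a homeomorphism that has a fixed point and has, for each $n\ge1$, only finitely many points $x$ with $T^n(x)=x$. An involution is a map $\imath$ with $\imath\circ\imath=\mathrm{id}$ (the identity is allowed). Halving: given a continuous involution $\imath:X\to X$ commuting with $T$, let $\sim$ be the equivalence relation on $X$ whose classes are the sets $[x]_\sim=\{x,\imath(x)\}$. The halved system $(\overline{X},\overline{T})$ consists of the quotient space $\overline{X}=X/{\sim}$ and the well-defined map $\overline{T}([x]_\sim)=[T(x)]_\sim$. For a map $S:Y\to Y$ and $n\ge1$, $\mathsf{F}_S(n)$ is the number of points $y\in Y$ with $S^n(y)=y$, and $\mathsf{O}_S(n)$ is the number of closed orbits of $S$ of length exactly $n$ (a closed orbit of length $n$ is a set $\{y,S(y),\dots,S^{n-1}(y)\}$ consisting of $n$ distinct points, with $S^n(y)=y$). *)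

theory Defs
  imports "HOL-Analysis.Analysis"
begin

definition fixed_count :: "'b set \<Rightarrow> ('b \<Rightarrow> 'b) \<Rightarrow> nat \<Rightarrow> nat" where
  "fixed_count Y S n = card {y \<in> Y. (S ^^ n) y = y}"

definition closed_orbits :: "'b set \<Rightarrow> ('b \<Rightarrow> 'b) \<Rightarrow> nat \<Rightarrow> 'b set set" where
  "closed_orbits Y S n =
    {C. \<exists>y\<in>Y. C = (\<lambda>k. (S ^^ k) y) ` {..<n} \<and> card C = n \<and> (S ^^ n) y = y}"

definition orbit_count :: "'b set \<Rightarrow> ('b \<Rightarrow> 'b) \<Rightarrow> nat \<Rightarrow> nat" where
  "orbit_count Y S n = card (closed_orbits Y S n)"

definition topological_dynamical_system :: "'a::metric_space set \<Rightarrow> ('a \<Rightarrow> 'a) \<Rightarrow> bool" where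
  "topological_dynamical_system X T \<longleftrightarrow>
    compact X \<and>
    (\<exists>T'. homeomorphism X X T T') \<and>
    (\<exists>x\<in>X. T x = x) \<and>
    (\<forall>n\<ge>1. finite {x \<in> X. (T ^^ n) x = x})"

definition involution_on :: "'a set \<Rightarrow> ('a \<Rightarrow> 'a) \<Rightarrow> bool" where
  "involution_on X \<iota> \<longleftrightarrow> \<iota> ` X \<subseteq> X \<and> (\<forall>x\<in>X. \<iota> (\<iota> x) = x)"

definition halving_rel :: "'a set \<Rightarrow> ('a \<Rightarrow> 'a) \<Rightarrow> ('a \<times> 'a) set" where
  "halving_rel X \<iota> = {(x, y). x \<in> X \<and> y \<in> X \<and> (y = x \<or> y = \<iota> x)}"

definition quotient_topology :: "'a topology \<Rightarrow> ('a \<times> 'a) set \<Rightarrow> 'a set topology" where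
  "quotient_topology X r = topology (\<lambda>\<U>. \<U> \<subseteq> topspace X // r \<and> openin X (\<Union>\<U>))"

definition halved_space :: "'a::metric_space set \<Rightarrow> ('a \<Rightarrow> 'a) \<Rightarrow> 'a set topology" where
  "halved_space X \<iota> = quotient_topology (top_of_set X) (halving_rel X \<iota>)"

(* On a class c this is the class of T x for any representative x in c;
   see halved_map_class below. *)
definition halved_map :: "'a set \<Rightarrow> ('a \<Rightarrow> 'a) \<Rightarrow> ('a \<Rightarrow> 'a) \<Rightarrow> 'a set \<Rightarrow> 'a set" where
  "halved_map X \<iota> T c = (\<Union>x\<in>c. halving_rel X \<iota> `` {T x})"

lemma equiv_halving_rel:
  assumes "involution_on X \<iota>"
  shows "equiv X (halving_rel X \<iota>)"
  using assms
  by (intro equivI) (auto simp: involution_on_def halving_rel_def refl_on_def sym_def trans_def)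

lemma halving_rel_class:
  assumes "involution_on X \<iota>" "x \<in> X"
  shows "halving_rel X \<iota> `` {x} = {x, \<iota> x}"
  using assms by (auto simp: involution_on_def halving_rel_def)

lemma openin_quotient_topology:
  assumes r: "equiv (topspace X) r"
  shows "openin (quotient_topology X r) \<U> \<longleftrightarrow> \<U> \<subseteq> topspace X // r \<and> openin X (\<Union>\<U>)"
proof -
  have "istopology (\<lambda>\<U>. \<U> \<subseteq> topspace X // r \<and> openin X (\<Union>\<U>))"
    unfolding istopology_def
  proof (intro conjI allI impI)
    fix S T assume S: "S \<subseteq> topspace X // r \<and> openin X (\<Union>S)"
      and T: "T \<subseteq> topspace X // r \<and> openin X (\<Union>T)"
    have "\<Union>(S \<inter> T) = \<Union>S \<inter> \<Union>T"
      using S T quotient_disj[OF r] by blast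
    then show "openin X (\<Union>(S \<inter> T))" using S T by (simp add: openin_Int)
    show "S \<inter> T \<subseteq> topspace X // r" using S by blast
  next
    fix K assume K: "\<forall>S\<in>K. S \<subseteq> topspace X // r \<and> openin X (\<Union>S)"
    then show "\<Union>K \<subseteq> topspace X // r" by blast
    have "\<Union>(\<Union>K) = (\<Union>S\<in>K. \<Union>S)" by blast
    moreover have "openin X (\<Union>S\<in>K. \<Union>S)" using K by blast
    ultimately show "openin X (\<Union>(\<Union>K))" by simp
  qed
  then show ?thesis by (simp add: quotient_topology_def topology_inverse')
qed

lemma topspace_quotient_topology:
  assumes r: "equiv (topspace X) r"
  shows "topspace (quotient_topology X r) = topspace X // r"
proof -
  have "openin (quotient_topology X r) (topspace X // r)"
    by (simp add: openin_quotient_topology[OF r] Union_quotient[OF r])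
  then show ?thesis
    using openin_quotient_topology[OF r] openin_topspace[of "quotient_topology X r"]
    by (meson openin_subset subset_antisym)
qed

lemma quotient_map_quotient_topology:
  assumes r: "equiv (topspace X) r"
  shows "quotient_map X (quotient_topology X r) (\<lambda>x. r `` {x})"
proof -
  have "\<Union>U = {x \<in> topspace X. r `` {x} \<in> U}" if U: "U \<subseteq> topspace X // r" for U
  proof (intro set_eqI iffI)
    fix x assume "x \<in> \<Union>U"
    then obtain c where c: "c \<in> U" "x \<in> c" by blast
    then obtain y where "y \<in> topspace X" "c = r `` {y}" using U by (auto elim: quotientE)
    with c have "c = r `` {x}" "x \<in> topspace X"
      using equiv_class_eq[OF r] r by (auto simp: equiv_def)
    with c show "x \<in> {x \<in> topspace X. r `` {x} \<in> U}" by simp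
  next
    fix x assume "x \<in> {x \<in> topspace X. r `` {x} \<in> U}"
    then show "x \<in> \<Union>U" using equiv_class_self[OF r] by blast
  qed
  then show ?thesis
    unfolding quotient_map_def topspace_quotient_topology[OF r] openin_quotient_topology[OF r]
    by (auto simp: quotient_def)
qed

lemma topspace_halved_space:
  assumes "involution_on X \<iota>"
  shows "topspace (halved_space X \<iota>) = X // halving_rel X \<iota>"
  using topspace_quotient_topology[of "top_of_set X"] equiv_halving_rel[OF assms]
  by (simp add: halved_space_def)

lemma halved_map_class:
  assumes i: "involution_on X \<iota>" and T: "T ` X \<subseteq> X"
    and comm: "\<And>x. x \<in> X \<Longrightarrow> \<iota> (T x) = T (\<iota> x)" and x: "x \<in> X"
  shows "halved_map X \<iota> T (halving_rel X \<iota> `` {x}) = halving_rel X \<iota> `` {T x}"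
proof -
  have "\<iota> x \<in> X" "T x \<in> X" "T (\<iota> x) \<in> X" "\<iota> (\<iota> x) = x"
    using i T x by (auto simp: involution_on_def)
  then show ?thesis
    unfolding halved_map_def halving_rel_class[OF i x]
    using comm[OF x] comm[of "\<iota> x"] by (auto simp: halving_rel_class[OF i])
qed

lemma halved_map_funpow_class:
  assumes i: "involution_on X \<iota>" and T: "T ` X \<subseteq> X"
    and comm: "\<And>x. x \<in> X \<Longrightarrow> \<iota> (T x) = T (\<iota> x)" and x: "x \<in> X"
  shows "(T ^^ n) x \<in> X \<and>
    (halved_map X \<iota> T ^^ n) (halving_rel X \<iota> `` {x}) = halving_rel X \<iota> `` {(T ^^ n) x}"
proof (induction n)
  case 0
  show ?case using x by simp
next
  case (Suc n)
  then show ?case using T halved_map_class[OF i T comm] by auto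
qed

lemma funpow_commute_on:
  assumes "T ` X \<subseteq> X" "\<And>x. x \<in> X \<Longrightarrow> \<iota> (T x) = T (\<iota> x)" "x \<in> X"
  shows "(T ^^ n) x \<in> X \<and> \<iota> ((T ^^ n) x) = (T ^^ n) (\<iota> x)"
  by (induction n) (use assms in auto)

(* The cardinalities counted for the halved system are those of finite sets. *)
lemma finite_fixed_points_halved:
  assumes tds: "topological_dynamical_system X T" and i: "involution_on X \<iota>"
    and comm: "\<And>x. x \<in> X \<Longrightarrow> \<iota> (T x) = T (\<iota> x)" and n: "n \<ge> 1"
  shows "finite {c \<in> topspace (halved_space X \<iota>). (halved_map X \<iota> T ^^ n) c = c}"
proof -
  let ?r = "halving_rel X \<iota>"
  have T: "T ` X \<subseteq> X"
    using tds by (auto simp: topological_dynamical_system_def homeomorphism_def)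
  have "{c \<in> topspace (halved_space X \<iota>). (halved_map X \<iota> T ^^ n) c = c}
    \<subseteq> (\<lambda>x. ?r `` {x}) ` {x \<in> X. (T ^^ (2 * n)) x = x}"
  proof
    fix c assume c: "c \<in> {c \<in> topspace (halved_space X \<iota>). (halved_map X \<iota> T ^^ n) c = c}"
    then obtain x where x: "x \<in> X" "c = ?r `` {x}"
      unfolding topspace_halved_space[OF i] by (auto elim: quotientE)
    let ?y = "(T ^^ n) x"
    have y: "?y \<in> X" "?r `` {?y} = ?r `` {x}"
      using halved_map_funpow_class[OF i T comm x(1), of n] c x by auto
    then have "?y = x \<or> ?y = \<iota> x"
      using x by (auto simp: halving_rel_class[OF i])
    moreover have "\<iota> ?y = (T ^^ n) (\<iota> x)" "\<iota> (\<iota> x) = x"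
      using funpow_commute_on[of T X \<iota> x n] T comm i x(1) by (auto simp: involution_on_def)
    ultimately have "(T ^^ n) ?y = x" by auto
    then have "(T ^^ (2 * n)) x = x" by (simp add: mult_2 funpow_add)
    with x show "c \<in> (\<lambda>x. ?r `` {x}) ` {x \<in> X. (T ^^ (2 * n)) x = x}" by blast
  qed
  moreover have "finite {x \<in> X. (T ^^ (2 * n)) x = x}"
    using tds n by (simp add: topological_dynamical_system_def)
  ultimately show ?thesis by (meson finite_imageI finite_subset)
qed

end

theory Submission
  imports Defs "HOL-Combinatorics.Cycles"
begin

text \<open>
  For part (a), let \<open>A\<close> and \<open>B\<close> be the sets of points with \<open>T\<^sup>n x = x\<close> and \<open>T\<^sup>n x = \<iota> x\<close>.
  A class is fixed by the \<open>n\<close>-th iterate of the halved map iff it lies in \<open>A\<close> or in \<open>B\<close>, and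
  every such class \<open>c\<close> satisfies \<open>|c \<inter> A| + |c \<inter> B| = 2\<close>: a class with two elements lies in exactly
  one of the two sets, and a class \<open>{x}\<close> with \<open>\<iota> x = x\<close> lies in both. Hence the halved system has
  exactly \<open>(|A| + |B|) / 2\<close> fixed points, and \<open>B\<close> is contained in the set of fixed points of
  \<open>T\<^sup>2\<^sup>n\<close>.

  For part (b), the least period of a point is a multiple of the least period of its class and
  divides twice that period. So a closed orbit of length \<open>n\<close> of the halved system is the
  projection of an orbit of length \<open>n\<close> or \<open>2n\<close>, and orbits of odd length keep their length under
  projection. The orbits with the same projection as \<open>C\<close> are \<open>C\<close> and \<open>\<iota> C\<close>.
\<close>

section \<open>Orbits and least periods of a single self-map\<close>

lemma funpow_mult_fixed:
  assumes "(f ^^ n) x = x"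
  shows "(f ^^ (k * n)) x = x"
  by (induction k) (use assms in \<open>simp_all add: funpow_add\<close>)

text \<open>Exponents may be reduced modulo \<open>n\<close>. The full range does not mention the
  period, so orbits of different lengths can be treated alike.\<close>

lemma orbit_eq_lessThan:
  assumes "(f ^^ n) x = x" and "n > 0"
  shows "range (\<lambda>k. (f ^^ k) x) = (\<lambda>k. (f ^^ k) x) ` {..<n}"
proof -
  have "(f ^^ k) x = (f ^^ (k mod n)) x" for k
    using funpow_mod_eq[OF assms(1)] by simp
  moreover have "k mod n \<in> {..<n}" for k using assms(2) by simp
  ultimately show ?thesis by blast
qed

lemma card_orbit_eq_least_power:
  assumes "(f ^^ n) x = x" and "n > 0"
  shows "card (range (\<lambda>k. (f ^^ k) x)) = least_power f x"
proof -
  let ?p = "least_power f x"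
  have p: "(f ^^ ?p) x = x" "?p > 0"
    using least_powerI[OF assms] by auto
  \<comment> \<open>Applying \<open>f ^^ (?p - j)\<close> to two equal iterates turns the later one
    into \<open>x\<close>, so \<open>?p - j + i\<close> would be a period below
    \<open>?p\<close>.\<close>
  have neq: "(f ^^ i) x \<noteq> (f ^^ j) x" if "i < j" "j < ?p" for i j
  proof
    assume "(f ^^ i) x = (f ^^ j) x"
    then have "(f ^^ (?p - j)) ((f ^^ i) x) = (f ^^ (?p - j)) ((f ^^ j) x)" by simp
    also have "\<dots> = (f ^^ (?p - j + j)) x" by (simp only: funpow_add o_apply)
    also have "\<dots> = x" using p(1) that by simp
    finally have "(f ^^ (?p - j + i)) x = x" by (simp only: funpow_add o_apply)
    from least_power_le[OF this] that show False by simp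
  qed
  have "inj_on (\<lambda>k. (f ^^ k) x) {..<?p}"
    by (rule inj_onI) (metis lessThan_iff linorder_neqE_nat neq)
  then show ?thesis by (simp add: orbit_eq_lessThan[OF p] card_image)
qed

lemma orbit_of_orbit_point:
  assumes "(f ^^ n) x = x" and "n > 0" and y: "y \<in> range (\<lambda>k. (f ^^ k) x)"
  shows "range (\<lambda>k. (f ^^ k) y) = range (\<lambda>k. (f ^^ k) x)"
proof -
  obtain m where m: "y = (f ^^ m) x" using y by blast
  have fwd: "(f ^^ k) y = (f ^^ (k + m)) x" for k
    by (simp add: m funpow_add)
  \<comment> \<open>Going forward \<open>m * n - m\<close> steps undoes the first \<open>m\<close>;
    the natural subtraction is exact because \<open>m \<le> m * n\<close>.\<close>
  have "(f ^^ k) x = (f ^^ (k + m * n - m)) y" for k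
  proof -
    have "m \<le> m * n" using assms(2) by simp
    then have "k + m * n - m + m = k + m * n" by linarith
    then have "(f ^^ (k + m * n - m)) y = (f ^^ (k + m * n)) x"
      by (simp only: fwd)
    also have "\<dots> = (f ^^ k) x"
      by (simp add: funpow_add funpow_mult_fixed[OF assms(1)])
    finally show ?thesis by simp
  qed
  with fwd show ?thesis by (metis (no_types, lifting) rangeI image_subsetI subset_antisym)
qed

text \<open>Turns length into a least period, so that divisibility applies. The clause
  \<open>(S ^^ n) y = y\<close> guarantees periodicity, without which \<open>least_power\<close> is
  unspecified.\<close>

lemma closed_orbits_iff:
  assumes "n > 0"
  shows "C \<in> closed_orbits Y S n \<longleftrightarrow>
    (\<exists>y\<in>Y. C = range (\<lambda>k. (S ^^ k) y) \<and> (S ^^ n) y = y \<and> least_power S y = n)"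
proof -
  have "C = (\<lambda>k. (S ^^ k) y) ` {..<n} \<and> card C = n \<and> (S ^^ n) y = y \<longleftrightarrow>
      C = range (\<lambda>k. (S ^^ k) y) \<and> (S ^^ n) y = y \<and> least_power S y = n" for y
    using orbit_eq_lessThan[of n S y] card_orbit_eq_least_power[of n S y] assms by auto
  then show ?thesis by (simp add: closed_orbits_def)
qed

lemma closed_orbits_point:
  assumes "n > 0" and C: "C \<in> closed_orbits Y S n" and "y \<in> C"
  shows "C = range (\<lambda>k. (S ^^ k) y)"
  using C assms(3) orbit_of_orbit_point[OF _ assms(1)]
  unfolding closed_orbits_iff[OF assms(1)] by metis

lemma finite_closed_orbits:
  assumes "n > 0" and "finite {y \<in> Y. (S ^^ n) y = y}"
  shows "finite (closed_orbits Y S n)"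
  by (rule finite_subset[OF _ finite_imageI[OF assms(2), of "\<lambda>y. range (\<lambda>k. (S ^^ k) y)"]])
    (auto simp: closed_orbits_iff[OF assms(1)])

section \<open>Iterates of the map on classes\<close>

locale halving =
  fixes X :: "'a set" and T \<iota> :: "'a \<Rightarrow> 'a"
  assumes map_into: "T ` X \<subseteq> X"
    and involution: "involution_on X \<iota>"
    and commute: "x \<in> X \<Longrightarrow> \<iota> (T x) = T (\<iota> x)"
begin

abbreviation proj :: "'a \<Rightarrow> 'a set" where
  "proj x \<equiv> halving_rel X \<iota> `` {x}"

abbreviation Xh :: "'a set set" where
  "Xh \<equiv> X // halving_rel X \<iota>"

abbreviation Th :: "'a set \<Rightarrow> 'a set" where
  "Th \<equiv> halved_map X \<iota> T"

lemma \<iota>_in: "x \<in> X \<Longrightarrow> \<iota> x \<in> X" and \<iota>_\<iota>: "x \<in> X \<Longrightarrow> \<iota> (\<iota> x) = x"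
  using involution by (auto simp: involution_on_def)

lemma proj_eq: "x \<in> X \<Longrightarrow> proj x = {x, \<iota> x}"
  by (rule halving_rel_class[OF involution])

lemma proj_in: "x \<in> X \<Longrightarrow> proj x \<in> Xh"
  by (rule quotientI)

lemma Xh_cases:
  assumes "c \<in> Xh" obtains x where "x \<in> X" "c = proj x"
  using assms by (auto elim: quotientE)

lemma proj_eq_iff:
  assumes "x \<in> X" "y \<in> X"
  shows "proj x = proj y \<longleftrightarrow> x = y \<or> x = \<iota> y"
  using assms \<iota>_\<iota> by (auto simp: proj_eq)

lemma funpow_in: "x \<in> X \<Longrightarrow> (T ^^ k) x \<in> X"
  using funpow_commute_on[of T X \<iota>, OF map_into commute] by blast

lemma funpow_\<iota>: "x \<in> X \<Longrightarrow> (T ^^ k) (\<iota> x) = \<iota> ((T ^^ k) x)"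
  using funpow_commute_on[of T X \<iota>, OF map_into commute] by simp

lemma Th_funpow: "x \<in> X \<Longrightarrow> (Th ^^ k) (proj x) = proj ((T ^^ k) x)"
  using halved_map_funpow_class[of X \<iota> T, OF involution map_into commute] by blast

lemma Th_fixed_iff:
  "x \<in> X \<Longrightarrow> (Th ^^ k) (proj x) = proj x \<longleftrightarrow> (T ^^ k) x = x \<or> (T ^^ k) x = \<iota> x"
  by (simp add: Th_funpow proj_eq_iff funpow_in)

text \<open>\<open>T ^^ k\<close> commutes with \<open>\<iota>\<close>, so applying it twice to
  \<open>x\<close> gives \<open>\<iota> (\<iota> x)\<close>.\<close>

lemma funpow_double_fixed:
  assumes "x \<in> X" and "(T ^^ k) x = \<iota> x"
  shows "(T ^^ (2 * k)) x = x"
  by (simp add: mult_2 funpow_add assms funpow_\<iota> \<iota>_\<iota>)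

lemma Th_fixed_double:
  assumes "x \<in> X" and "(Th ^^ k) (proj x) = proj x"
  shows "(T ^^ (2 * k)) x = x"
  using assms funpow_double_fixed funpow_mult_fixed Th_fixed_iff by metis

lemma proj_orbit:
  "x \<in> X \<Longrightarrow> proj ` range (\<lambda>k. (T ^^ k) x) = range (\<lambda>k. (Th ^^ k) (proj x))"
  by (simp add: image_image Th_funpow)

text \<open>Any period of a point is a period of its class; \<open>m\<close> witnesses that
  \<open>x\<close> is periodic.\<close>

lemma least_power_proj_dvd:
  assumes "x \<in> X" and "(T ^^ m) x = x" and "m > 0"
  shows "least_power Th (proj x) dvd least_power T x"
proof (rule least_power_minimal)
  show "(Th ^^ least_power T x) (proj x) = proj x"
    using least_powerI(1)[OF assms(2,3)] assms(1) by (simp add: Th_funpow)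
qed

text \<open>One period of the class may carry \<open>x\<close> to \<open>\<iota> x\<close>; a second
  one then brings it back.\<close>

lemma least_power_dvd_double_proj:
  assumes "x \<in> X" and "(Th ^^ m) (proj x) = proj x" and "m > 0"
  shows "least_power T x dvd 2 * least_power Th (proj x)"
  using Th_fixed_double[OF assms(1) least_powerI(1)[OF assms(2,3)]] by (rule least_power_minimal)

section \<open>Counting fixed points of the halved map\<close>

lemma double_fixed_count_halved:
  assumes fin: "finite {x \<in> X. (T ^^ (2 * n)) x = x}"
  shows "2 * card {c \<in> Xh. (Th ^^ n) c = c} =
    card {x \<in> X. (T ^^ n) x = x} + card {x \<in> X. (T ^^ n) x = \<iota> x}"
proof -
  define A where "A = {x \<in> X. (T ^^ n) x = x}"
  define B where "B = {x \<in> X. (T ^^ n) x = \<iota> x}"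
  define F where "F = {c \<in> Xh. (Th ^^ n) c = c}"
  have "A \<subseteq> {x \<in> X. (T ^^ (2 * n)) x = x}" "B \<subseteq> {x \<in> X. (T ^^ (2 * n)) x = x}"
    using funpow_mult_fixed[of n T _ 2] funpow_double_fixed by (auto simp: A_def B_def)
  then have finA: "finite A" and finB: "finite B"
    using fin finite_subset by blast+
  have "proj x \<in> F \<longleftrightarrow> x \<in> A \<union> B" if "x \<in> X" for x
    using that proj_in by (simp add: F_def A_def B_def Th_fixed_iff)
  then have F: "F = proj ` (A \<union> B)"
    unfolding F_def A_def B_def by (blast elim: Xh_cases)
  then have finF: "finite F" using finA finB by simp
  have two: "card (c \<inter> A) + card (c \<inter> B) = 2" if "c \<in> F" for c
  proof -
    have "c \<in> proj ` (A \<union> B)" using that F by simp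
    then obtain x where "c = proj x" "x \<in> A \<union> B" by (rule imageE)
    then have x: "x \<in> X" "c = proj x" "x \<in> A \<or> x \<in> B"
      by (simp_all add: A_def B_def) blast
    have c: "c = {x, \<iota> x}" using x by (simp add: proj_eq)
    \<comment> \<open>\<open>T ^^ n\<close> commutes with \<open>\<iota>\<close>, so
      \<open>A\<close> and \<open>B\<close> are unions of whole classes.\<close>
    have \<iota>A: "\<iota> x \<in> A \<longleftrightarrow> x \<in> A"
      using x(1) \<iota>_in[OF x(1)] \<iota>_\<iota>[OF x(1)] \<iota>_\<iota>[OF funpow_in[OF x(1), of n]]
      unfolding A_def mem_Collect_eq funpow_\<iota>[OF x(1)] by metis
    have \<iota>B: "\<iota> x \<in> B \<longleftrightarrow> x \<in> B"
      using x(1) \<iota>_in[OF x(1)] \<iota>_\<iota>[OF x(1)] \<iota>_\<iota>[OF funpow_in[OF x(1), of n]]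
      unfolding B_def mem_Collect_eq funpow_\<iota>[OF x(1)] by metis
    show ?thesis
    proof (cases "\<iota> x = x")
      case True
      then have "x \<in> A" "x \<in> B" using x by (auto simp: A_def B_def)
      with True c show ?thesis by simp
    next
      case False
      \<comment> \<open>A point of both sets satisfies
        \<open>x = (T ^^ n) x = \<iota> x\<close>.\<close>
      then have "\<not> (x \<in> A \<and> x \<in> B)" by (auto simp: A_def B_def)
      then have "c \<subseteq> A \<and> c \<inter> B = {} \<or> c \<subseteq> B \<and> c \<inter> A = {}"
        using x(3) c \<iota>A \<iota>B by auto
      moreover have "card c = 2" using False c by simp
      ultimately show ?thesis by (auto simp: Int_absorb2)
    qed
  qed
  \<comment> \<open>The classes in \<open>F\<close> are disjoint and cover \<open>D\<close>, so
    \<open>D\<close> can be counted class by class; this is applied to \<open>A\<close> and to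
    \<open>B\<close>.\<close>
  have split: "card D = (\<Sum>c\<in>F. card (c \<inter> D))" if "finite D" "D \<subseteq> A \<union> B" for D
  proof -
    have D: "D = (\<Union>c\<in>F. c \<inter> D)"
      using that(2) unfolding F A_def B_def by (auto simp: proj_eq)
    have "(c \<inter> D) \<inter> (d \<inter> D) = {}" if "c \<in> F" "d \<in> F" "c \<noteq> d" for c d
      using quotient_disj[OF equiv_halving_rel[OF involution], of c d] that
      by (auto simp: F_def)
    with finF that(1) have "card (\<Union>c\<in>F. c \<inter> D) = (\<Sum>c\<in>F. card (c \<inter> D))"
      by (intro card_UN_disjoint) auto
    with D show ?thesis by simp
  qed
  have "card A + card B = (\<Sum>c\<in>F. card (c \<inter> A) + card (c \<inter> B))"
    by (simp add: split finA finB sum.distrib)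
  also have "\<dots> = 2 * card F" by (simp add: two)
  finally show ?thesis by (simp add: A_def B_def F_def)
qed

section \<open>Counting closed orbits of the halved map\<close>

lemma closed_orbits_halved_subset:
  assumes "n > 0"
  shows "closed_orbits Xh Th n \<subseteq>
    (`) proj ` (closed_orbits X T n \<union> closed_orbits X T (2 * n))"
proof
  fix D assume "D \<in> closed_orbits Xh Th n"
  then obtain x where x: "x \<in> X" "D = range (\<lambda>k. (Th ^^ k) (proj x))"
      "(Th ^^ n) (proj x) = proj x" "least_power Th (proj x) = n"
    unfolding closed_orbits_iff[OF assms] by (metis Xh_cases)
  let ?p = "least_power T x"
  have fix2: "(T ^^ (2 * n)) x = x" by (rule Th_fixed_double[OF x(1,3)])
  then have p: "(T ^^ ?p) x = x" "?p > 0"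
    using least_powerI[OF fix2] assms by auto
  obtain m where m: "?p = n * m"
    using least_power_proj_dvd[OF x(1) fix2] assms x(4) by auto
  have "n * m dvd n * 2"
    using least_power_dvd_double_proj[OF x(1,3) assms] x(4) m by (simp add: mult.commute)
  then have "m dvd 2" using assms by simp
  then have "m = 1 \<or> m = 2" using two_is_prime_nat prime_nat_iff by blast
  then have "?p = n \<or> ?p = 2 * n" using m by auto
  then have "range (\<lambda>k. (T ^^ k) x) \<in> closed_orbits X T n \<union> closed_orbits X T (2 * n)"
    using p x(1) assms by (auto simp: closed_orbits_iff)
  moreover have "D = proj ` range (\<lambda>k. (T ^^ k) x)"
    using proj_orbit[OF x(1)] x(2) by simp
  ultimately show "D \<in> (`) proj ` (closed_orbits X T n \<union> closed_orbits X T (2 * n))"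
    by blast
qed

lemma proj_closed_orbit_odd:
  assumes "odd n" and C: "C \<in> closed_orbits X T n"
  shows "proj ` C \<in> closed_orbits Xh Th n"
proof -
  have n: "n > 0" using assms(1) by (rule odd_pos)
  obtain x where x: "x \<in> X" "C = range (\<lambda>k. (T ^^ k) x)" "(T ^^ n) x = x" "least_power T x = n"
    using C unfolding closed_orbits_iff[OF n] by blast
  have fixh: "(Th ^^ n) (proj x) = proj x" using x by (simp add: Th_funpow)
  have "n dvd 2 * least_power Th (proj x)"
    using least_power_dvd_double_proj[OF x(1) fixh n] x(4) by simp
  \<comment> \<open>Oddness enters here: \<open>n\<close> is coprime to 2, so the factor 2 that
    stems from a possible swap by \<open>\<iota>\<close> cancels.\<close>
  then have "n dvd least_power Th (proj x)"
    using assms(1) by (metis coprime_dvd_mult_right_iff coprime_right_2_iff_odd)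
  moreover have "least_power Th (proj x) dvd n"
    using least_power_proj_dvd[OF x(1,3) n] x(4) by simp
  ultimately have "least_power Th (proj x) = n" by (rule dvd_antisym[symmetric])
  then show ?thesis
    unfolding closed_orbits_iff[OF n] using x(1,2) fixh proj_orbit proj_in by blast
qed

text \<open>A class common to both projections yields points of \<open>C\<close> and
  \<open>D\<close> that agree up to \<open>\<iota>\<close>; any point generates its whole orbit, and
  \<open>\<iota>\<close> carries orbits to orbits.\<close>

lemma closed_orbits_same_proj:
  assumes n: "n > 0" and C: "C \<in> closed_orbits X T n" and D: "D \<in> closed_orbits X T n"
    and eq: "proj ` C = proj ` D"
  shows "C = D \<or> C = \<iota> ` D"
proof -
  obtain x where x: "x \<in> X" "C = range (\<lambda>k. (T ^^ k) x)"
    using C unfolding closed_orbits_iff[OF n] by blast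
  have "x \<in> C" unfolding x(2) by (rule range_eqI[of _ _ 0]) simp
  then have "proj x \<in> proj ` D" using eq by blast
  then obtain y where y: "y \<in> D" "proj x = proj y" by (rule imageE)
  have "D \<subseteq> X" using D funpow_in unfolding closed_orbits_iff[OF n] by auto
  then have yX: "y \<in> X" using y by blast
  have D_eq: "D = range (\<lambda>k. (T ^^ k) y)" by (rule closed_orbits_point[OF n D y(1)])
  have "x = y \<or> x = \<iota> y" using y(2) x(1) yX by (simp add: proj_eq_iff)
  then show ?thesis using x(2) D_eq yX by (auto simp: funpow_\<iota> image_image)
qed

lemma card_closed_orbits_odd_le:
  assumes "odd n" and fin: "finite (closed_orbits Xh Th n)"
  shows "card (closed_orbits X T n) \<le> 2 * card (closed_orbits Xh Th n)"
proof -
  have n: "n > 0" using assms(1) by (rule odd_pos)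
  let ?O = "closed_orbits X T n" and ?Oh = "closed_orbits Xh Th n"
  \<comment> \<open>\<open>s\<close> selects one orbit over each projected orbit, and
    \<open>\<iota>\<close> gives the only other candidate. Where no orbit projects to
    \<open>D\<close>, the value \<open>s D\<close> is arbitrary; this is harmless, since
    \<open>?O\<close> need only be covered.\<close>
  define s where "s D = (SOME C. C \<in> ?O \<and> proj ` C = D)" for D
  have sub: "?O \<subseteq> s ` ?Oh \<union> (\<lambda>D. \<iota> ` s D) ` ?Oh"
  proof
    fix C assume C: "C \<in> ?O"
    have "s (proj ` C) \<in> ?O \<and> proj ` s (proj ` C) = proj ` C"
      unfolding s_def by (rule someI[of _ C]) (use C in simp)
    then have "C = s (proj ` C) \<or> C = \<iota> ` s (proj ` C)"
      using closed_orbits_same_proj[OF n C] by metis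
    then show "C \<in> s ` ?Oh \<union> (\<lambda>D. \<iota> ` s D) ` ?Oh"
      using proj_closed_orbit_odd[OF assms(1) C] by blast
  qed
  have "card ?O \<le> card (s ` ?Oh \<union> (\<lambda>D. \<iota> ` s D) ` ?Oh)"
    using fin sub by (intro card_mono) auto
  also have "\<dots> \<le> card (s ` ?Oh) + card ((\<lambda>D. \<iota> ` s D) ` ?Oh)" by (rule card_Un_le)
  also have "\<dots> \<le> card ?Oh + card ?Oh" by (intro add_mono card_image_le fin)
  finally show ?thesis by simp
qed

end

theorem lemma5:
  fixes X :: "'a::metric_space set" and T \<iota> :: "'a \<Rightarrow> 'a" and n :: nat
  assumes "topological_dynamical_system X T"
    and "involution_on X \<iota>"
    and "continuous_on X \<iota>"
    and "\<forall>x\<in>X. \<iota> (T x) = T (\<iota> x)"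
    and "n \<ge> 1"
  defines "Xbar \<equiv> topspace (halved_space X \<iota>)"
    and "Tbar \<equiv> halved_map X \<iota> T"
  shows "(1/2) * real (fixed_count X T n) \<le> real (fixed_count Xbar Tbar n)
      \<and> real (fixed_count Xbar Tbar n)
          \<le> (1/2) * (real (fixed_count X T n) + real (fixed_count X T (2 * n)))
      \<and> orbit_count Xbar Tbar n \<le> orbit_count X T n + orbit_count X T (2 * n)
      \<and> (odd n \<longrightarrow> real (orbit_count Xbar Tbar n) \<ge> (1/2) * real (orbit_count X T n))"
proof -
  interpret halving X T \<iota>
    using assms(1,2,4) by unfold_locales
      (auto simp: topological_dynamical_system_def homeomorphism_def)
  have Xbar: "Xbar = Xh" unfolding Xbar_def by (rule topspace_halved_space[OF assms(2)])
  have n: "n > 0" "2 * n > 0" using assms(5) by auto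
  have fin: "finite {x \<in> X. (T ^^ m) x = x}" if "m > 0" for m
    using assms(1) that by (simp add: topological_dynamical_system_def)
  have finh: "finite {c \<in> Xh. (Th ^^ n) c = c}"
    using finite_fixed_points_halved[of X T \<iota>, OF assms(1,2) commute assms(5)]
    by (simp add: topspace_halved_space[OF assms(2)])
  have "card {x \<in> X. (T ^^ n) x = \<iota> x} \<le> fixed_count X T (2 * n)"
    unfolding fixed_count_def using fin[OF n(2)] funpow_double_fixed by (intro card_mono) auto
  \<comment> \<open>Dropping the count of points with \<open>(T ^^ n) x = \<iota> x\<close> gives
    the lower bound; bounding it by the \<open>2 * n\<close> count gives the upper.\<close>
  then have a: "fixed_count X T n \<le> 2 * fixed_count Xbar Tbar n"
      "2 * fixed_count Xbar Tbar n \<le> fixed_count X T n + fixed_count X T (2 * n)"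
    using double_fixed_count_halved[OF fin[OF n(2)]]
    by (simp_all add: fixed_count_def Xbar Tbar_def)
  \<comment> \<open>Finiteness matters because \<open>card\<close> of an infinite set is 0, so a
    bare inclusion would bound nothing.\<close>
  have finO: "finite (closed_orbits X T n \<union> closed_orbits X T (2 * n))"
    using finite_closed_orbits[OF n(1) fin[OF n(1)]] finite_closed_orbits[OF n(2) fin[OF n(2)]]
    by simp
  have "card (closed_orbits Xh Th n) \<le> card (closed_orbits X T n \<union> closed_orbits X T (2 * n))"
    by (rule surj_card_le[OF finO closed_orbits_halved_subset[OF n(1)]])
  also have "\<dots> \<le> orbit_count X T n + orbit_count X T (2 * n)"
    unfolding orbit_count_def by (rule card_Un_le)
  finally have b: "orbit_count Xbar Tbar n \<le> orbit_count X T n + orbit_count X T (2 * n)"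
    by (simp add: orbit_count_def Xbar Tbar_def)
  have "orbit_count X T n \<le> 2 * orbit_count Xbar Tbar n" if "odd n"
    using card_closed_orbits_odd_le[OF that finite_closed_orbits[OF n(1) finh]]
    by (simp add: orbit_count_def Xbar Tbar_def)
  with a b show ?thesis by auto
qed

end
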